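(* Let $N\ge 1$ and let $a,b$ be distinct integers with $\gcd(N,a,b)=1$, and suppose the double-step graph $G(N;\pm a,\pm b)$ has diameter $k$. Let $N\!A$ be the New Amsterdam digraph on $2N$ vertices with steps $$\alpha=-1,\qquad \beta=2(b-a)-1,\qquad \gamma=2a+1,\qquad \delta=-2b+1,$$ that is, the digraph with vertex set $\mathbb{Z}_{2N}$ in which every even vertex $i$ has arcs to $i+\alpha$ and $i+\beta$, and every odd vertex $j$ has arcs to $j+\gamma$ and $j+\delta$ (arithmetic modulo $2N$). Then the diameter $D_{NA}$ of $N\!A$ satisfies $$2k\le D_{NA}\le 2k+1.$$
   Context: A double-step graph $G(N;\pm a,\pm b)$ has vertex set $\mathbb{Z}_N$, and each vertex $i$ is adjacent to $i\pm a$ and $i\pm b$ (mod $N$), where $a,b$ are distinct integers (the steps) with $\gcd(N,a,b)=1$; its diameter is the usual graph diameter. A New Amsterdam digraph $N\!A(M;\alpha,\beta,\gamma,\delta)$, for even $M$ and odd integers $\alpha\neq\beta,\gamma,\delta$ with $\alpha+\beta+\gamma+\delta\equiv 0 \pmod M$, is the bipartite digraph on $\mathbb{Z}_M$ where each even vertex $i$ has arcs to $i+\alpha,i+\beta$ and each odd vertex $j$ has arcs to $j+\gamma,j+\delta$ (mod $M$). The diameter of a digraph is the maximum, over ordered pairs of vertices $(u,v)$, of the length of a shortest directed path from $u$ to $v$. *)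

theory Defs
  imports "Graph_Theory.Graph_Theory" "HOL-Library.Extended_Nat"
begin

text \<open>
  Distances are extended naturals: the infimum over the empty set is \<open>\<infinity>\<close>, so a digraph that is
  not strongly connected has diameter \<open>\<infinity>\<close>. On a finite nonempty vertex set the supremum
  in the diameter is a maximum.
\<close>

definition digraph_dist :: "('a, 'b) pre_digraph \<Rightarrow> 'a \<Rightarrow> 'a \<Rightarrow> enat" where
  "digraph_dist G u v = (INF p \<in> {p. pre_digraph.apath G u p v}. enat (length p))"

definition digraph_diameter :: "('a, 'b) pre_digraph \<Rightarrow> enat" where
  "digraph_diameter G = (SUP (u, v) \<in> verts G \<times> verts G. digraph_dist G u v)"

text \<open>
  The integers modulo \<open>N\<close> are represented by \<open>{0..<int N}\<close>. As usual in \<^theory>\<open>Graph_Theory.Digraph\<close>,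
  an undirected graph is a symmetric digraph. Loops or coinciding arcs, which occur when the steps
  degenerate modulo \<open>N\<close>, do not affect distances.
\<close>

definition double_step_graph :: "nat \<Rightarrow> int \<Rightarrow> int \<Rightarrow> int pair_pre_digraph" where
  "double_step_graph N a b =
     \<lparr> pverts = {0..<int N},
       parcs = {(i, (i + s) mod int N) | i s. i \<in> {0..<int N} \<and> s \<in> {a, - a, b, - b}} \<rparr>"

text \<open>
  Meant for even \<open>M\<close> and odd steps; then the parity of a residue class modulo \<open>M\<close> is that of its
  representative in \<open>{0..<int M}\<close>.
\<close>

definition new_amsterdam :: "nat \<Rightarrow> int \<Rightarrow> int \<Rightarrow> int \<Rightarrow> int \<Rightarrow> int pair_pre_digraph" where
  "new_amsterdam M \<alpha> \<beta> \<gamma> \<delta> =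
     \<lparr> pverts = {0..<int M},
       parcs = {(i, (i + s) mod int M) | i s. i \<in> {0..<int M} \<and> even i \<and> s \<in> {\<alpha>, \<beta>}}
             \<union> {(j, (j + s) mod int M) | j s. j \<in> {0..<int M} \<and> odd j \<and> s \<in> {\<gamma>, \<delta>}} \<rparr>"

lemma pair_sym_digraph_double_step_graph: "pair_sym_digraph (double_step_graph N a b)"
proof unfold_locales
  have "(v, u) \<in> parcs (double_step_graph N a b)" if "(u, v) \<in> parcs (double_step_graph N a b)" for u v
  proof -
    from that obtain s where s: "u \<in> {0..<int N}" "s \<in> {a, - a, b, - b}" "v = (u + s) mod int N"
      by (auto simp: double_step_graph_def)
    have "(v + - s) mod int N = u"
      using s(1) by (simp add: s(3) mod_diff_left_eq)
    moreover have "- s \<in> {a, - a, b, - b}" "v \<in> {0..<int N}"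
      using s by auto
    ultimately show ?thesis
      unfolding double_step_graph_def by (auto intro!: exI[of _ "- s"])
  qed
  then show "symmetric (with_proj (double_step_graph N a b))"
    by (auto simp: symmetric_def sym_def)
qed (auto simp: double_step_graph_def)

lemma pair_wf_digraph_new_amsterdam: "pair_wf_digraph (new_amsterdam M \<alpha> \<beta> \<gamma> \<delta>)"
  by unfold_locales (auto simp: new_amsterdam_def)

end

theory Submission
  imports Defs
begin

text \<open>
  Two consecutive arcs of the New Amsterdam digraph, whatever the parity of the first vertex, add up
  to one of \<open>\<alpha> + \<gamma>\<close>, \<open>\<alpha> + \<delta>\<close>, \<open>\<beta> + \<gamma>\<close>, \<open>\<beta> + \<delta>\<close>, that is, to \<open>\<plusminus>2a\<close> or \<open>\<plusminus>2b\<close>. So its square consists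
  of two copies of the double-step graph, one on the even and one on the odd vertices, and every arc
  changes the parity. Distances between vertices of equal parity are therefore exactly twice the
  distances in the double-step graph, and vertices of different parity need at most one more arc.
\<close>

section \<open>Distances and powers of the arc relation\<close>

context wf_digraph
begin

lemma ex_awalk_length_iff_relpow:
  "(\<exists>p. awalk u p v \<and> length p = n) \<longleftrightarrow> u \<in> verts G \<and> (u, v) \<in> arcs_ends G ^^ n"
proof (induction n arbitrary: u)
  case 0
  show ?case by (auto simp: awalk_Nil_iff)
next
  case (Suc n)
  have "(\<exists>p. awalk u p v \<and> length p = Suc n) \<longleftrightarrow> (\<exists>e p. awalk u (e # p) v \<and> length p = n)"
    by (metis length_Suc_conv)
  also have "\<dots> \<longleftrightarrow>
      (\<exists>e \<in> arcs G. u = tail G e \<and> (\<exists>p. awalk (head G e) p v \<and> length p = n))"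
    by (auto simp: awalk_Cons_iff)
  also have "\<dots> \<longleftrightarrow> (\<exists>w. u \<rightarrow>\<^bsub>G\<^esub> w \<and> (w, v) \<in> arcs_ends G ^^ n)"
    unfolding Suc.IH by (auto simp: arcs_ends_conv)
  also have "\<dots> \<longleftrightarrow> u \<in> verts G \<and> (u, v) \<in> arcs_ends G ^^ Suc n"
    by (meson adj_in_verts(1) relpow_Suc_D2 relpow_Suc_I2)
  finally show ?case .
qed

lemma length_awalk_to_apath_le:
  assumes "awalk u p v"
  shows "length (awalk_to_apath p) \<le> length p"
proof -
  have cost: "awalk_cost (\<lambda>_. 1) q = real (length q)" for q
    by (induction q) simp_all
  show ?thesis
    using awalk_to_path_no_neg_cyc_cost[OF assms, of "\<lambda>_. 1"] by (simp add: cost)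
qed

lemma digraph_dist_le_relpow:
  assumes "u \<in> verts G" "(u, v) \<in> arcs_ends G ^^ n"
  shows "digraph_dist G u v \<le> enat n"
proof -
  obtain p where walk: "awalk u p v" "length p = n"
    using assms ex_awalk_length_iff_relpow by blast
  have "digraph_dist G u v \<le> enat (length (awalk_to_apath p))"
    unfolding digraph_dist_def by (rule INF_lower) (simp add: apath_awalk_to_apath[OF walk(1)])
  also have "\<dots> \<le> enat n"
    using length_awalk_to_apath_le[OF walk(1)] walk(2) by simp
  finally show ?thesis .
qed

lemma relpow_if_digraph_dist_eq:
  assumes "digraph_dist G u v = enat n"
  shows "(u, v) \<in> arcs_ends G ^^ n"
proof -
  define L where "L = (\<lambda>p. enat (length p)) ` {p. apath u p v}"
  have Inf_L: "Inf L = enat n"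
    using assms by (simp only: digraph_dist_def L_def)
  then have "L \<noteq> {}"
    by (auto simp: top_enat_def)
  then have "enat n \<in> L"
    using Inf_L wellorder_InfI by (metis ex_in_conv)
  then obtain p where "apath u p v" "length p = n"
    by (auto simp: L_def)
  then show ?thesis
    using ex_awalk_length_iff_relpow awalkI_apath by blast
qed

lemma digraph_dist_le_eSuc_if_arc:
  assumes "u \<rightarrow>\<^bsub>G\<^esub> v"
  shows "digraph_dist G u w \<le> eSuc (digraph_dist G v w)"
proof (cases "digraph_dist G v w")
  case (enat n)
  then have "(u, w) \<in> arcs_ends G ^^ Suc n"
    using assms relpow_if_digraph_dist_eq by (blast intro: relpow_Suc_I2)
  then show ?thesis
    using digraph_dist_le_relpow adj_in_verts(1)[OF assms] enat by (simp add: eSuc_enat)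
qed simp

end

lemma digraph_dist_le_diameter:
  "u \<in> verts G \<Longrightarrow> v \<in> verts G \<Longrightarrow> digraph_dist G u v \<le> digraph_diameter G"
  unfolding digraph_diameter_def by (rule SUP_upper2[of "(u, v)"]) simp_all

lemma digraph_diameter_leI:
  "(\<And>u v. u \<in> verts G \<Longrightarrow> v \<in> verts G \<Longrightarrow> digraph_dist G u v \<le> d) \<Longrightarrow> digraph_diameter G \<le> d"
  unfolding digraph_diameter_def by (auto intro: SUP_least)

section \<open>Bipartite digraphs whose square consists of two copies of a digraph\<close>

locale bipartite_square_root = A: wf_digraph A + G: wf_digraph G
  for A :: "('a, 'b) pre_digraph" and G :: "('c, 'd) pre_digraph" +
  fixes side :: "'a \<Rightarrow> bool" and proj :: "'a \<Rightarrow> 'c"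
  assumes arc_changes_side: "u \<rightarrow>\<^bsub>A\<^esub> v \<Longrightarrow> side v \<longleftrightarrow> \<not> side u"
    and ex_arc: "u \<in> verts A \<Longrightarrow> \<exists>v. u \<rightarrow>\<^bsub>A\<^esub> v"
    and bij_betw_verts: "bij_betw (\<lambda>u. (side u, proj u)) (verts A) (UNIV \<times> verts G)"
    and two_arcs_iff: "\<lbrakk>u \<in> verts A; v \<in> verts A; side u = side v\<rbrakk>
      \<Longrightarrow> (u, v) \<in> arcs_ends A ^^ 2 \<longleftrightarrow> proj u \<rightarrow>\<^bsub>G\<^esub> proj v"
begin

lemma side_relpow:
  "(u, v) \<in> arcs_ends A ^^ n \<Longrightarrow> side v \<longleftrightarrow> (side u \<longleftrightarrow> even n)"
  by (induction n arbitrary: v) (auto dest: arc_changes_side)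

lemma proj_eq_iff:
  "\<lbrakk>u \<in> verts A; v \<in> verts A; side u = side v\<rbrakk> \<Longrightarrow> proj u = proj v \<longleftrightarrow> u = v"
  using bij_betw_imp_inj_on[OF bij_betw_verts] by (auto dest: inj_onD)

lemma proj_in_verts: "u \<in> verts A \<Longrightarrow> proj u \<in> verts G"
  using bij_betwE[OF bij_betw_verts] by auto

lemma obtain_vertex_over:
  assumes "x \<in> verts G"
  obtains u where "u \<in> verts A" "side u = s" "proj u = x"
proof -
  have "(s, x) \<in> (\<lambda>u. (side u, proj u)) ` verts A"
    using assms bij_betw_imp_surj_on[OF bij_betw_verts] by simp
  then show thesis using that by blast
qed

lemma relpow_double_iff:
  assumes "u \<in> verts A" "v \<in> verts A" "side u = side v"
  shows "(u, v) \<in> arcs_ends A ^^ (2 * n) \<longleftrightarrow> (proj u, proj v) \<in> arcs_ends G ^^ n"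
  using assms
proof (induction n arbitrary: u)
  case 0
  then show ?case by (simp add: proj_eq_iff)
next
  case (Suc n)
  have same_side: "w \<in> verts A \<and> side w = side v" if "(u, w) \<in> arcs_ends A ^^ 2" for w
    using that Suc.prems side_relpow[OF that]
    by (auto simp: numeral_2_eq_2 dest: A.adj_in_verts)
  have "arcs_ends A ^^ (2 * Suc n) = arcs_ends A ^^ 2 O arcs_ends A ^^ (2 * n)"
    by (simp flip: relpow_add)
  then have "(u, v) \<in> arcs_ends A ^^ (2 * Suc n) \<longleftrightarrow>
      (\<exists>w \<in> verts A. side w = side v \<and> (u, w) \<in> arcs_ends A ^^ 2 \<and> (w, v) \<in> arcs_ends A ^^ (2 * n))"
    using same_side by (auto simp: relcomp_unfold)
  also have "\<dots> \<longleftrightarrow> (\<exists>w \<in> verts A. side w = side v \<and>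
      proj u \<rightarrow>\<^bsub>G\<^esub> proj w \<and> (proj w, proj v) \<in> arcs_ends G ^^ n)"
    using Suc by (metis two_arcs_iff)
  also have "\<dots> \<longleftrightarrow> (\<exists>x. proj u \<rightarrow>\<^bsub>G\<^esub> x \<and> (x, proj v) \<in> arcs_ends G ^^ n)"
    by (metis G.adj_in_verts(2) obtain_vertex_over)
  also have "\<dots> \<longleftrightarrow> (proj u, proj v) \<in> arcs_ends G ^^ Suc n"
    by (meson relpow_Suc_D2 relpow_Suc_I2)
  finally show ?case .
qed

lemma digraph_dist_same_side:
  assumes "u \<in> verts A" "v \<in> verts A" "side u = side v"
  shows "digraph_dist A u v = 2 * digraph_dist G (proj u) (proj v)"
proof (rule antisym)
  show "digraph_dist A u v \<le> 2 * digraph_dist G (proj u) (proj v)"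
  proof (cases "digraph_dist G (proj u) (proj v)")
    case (enat n)
    then have "(u, v) \<in> arcs_ends A ^^ (2 * n)"
      using assms G.relpow_if_digraph_dist_eq relpow_double_iff by blast
    then show ?thesis
      using A.digraph_dist_le_relpow[OF assms(1)] enat by (simp add: numeral_eq_enat)
  qed (simp add: imult_infinity_right)
next
  show "2 * digraph_dist G (proj u) (proj v) \<le> digraph_dist A u v"
  proof (cases "digraph_dist A u v")
    case (enat n)
    then have walk: "(u, v) \<in> arcs_ends A ^^ n"
      by (rule A.relpow_if_digraph_dist_eq)
    then obtain m where n_eq: "n = 2 * m"
      using side_relpow assms(3) by blast
    then have "digraph_dist G (proj u) (proj v) \<le> enat m"
      using walk n_eq relpow_double_iff[OF assms] assms(1)
      by (simp add: G.digraph_dist_le_relpow proj_in_verts)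
    then have "2 * digraph_dist G (proj u) (proj v) \<le> 2 * enat m"
      by (rule mult_left_mono) simp
    then show ?thesis
      using enat n_eq by (simp add: numeral_eq_enat)
  qed simp
qed

lemma diameter_lower_bound: "2 * digraph_diameter G \<le> digraph_diameter A"
proof (cases "digraph_diameter A")
  case (enat d)
  have "digraph_dist G x y \<le> enat (d div 2)" if in_verts: "x \<in> verts G" "y \<in> verts G" for x y
  proof -
    obtain u v where "u \<in> verts A" "v \<in> verts A" "side u = side v" "proj u = x" "proj v = y"
      using in_verts by (metis obtain_vertex_over)
    then have "2 * digraph_dist G x y \<le> enat d"
      using digraph_dist_le_diameter digraph_dist_same_side enat by metis
    then show ?thesis
      by (cases "digraph_dist G x y") (auto simp: numeral_eq_enat imult_is_infinity)
  qed
  then have "2 * digraph_diameter G \<le> 2 * enat (d div 2)"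
    by (intro mult_left_mono digraph_diameter_leI) simp_all
  also have "\<dots> \<le> enat d"
    by (simp add: numeral_eq_enat)
  finally show ?thesis
    using enat by simp
qed simp

lemma diameter_upper_bound: "digraph_diameter A \<le> 2 * digraph_diameter G + 1"
proof (rule digraph_diameter_leI)
  fix u v assume u: "u \<in> verts A" and v: "v \<in> verts A"
  have same_side: "digraph_dist A w v \<le> 2 * digraph_diameter G"
    if "w \<in> verts A" "side w = side v" for w
    using that v
    by (simp add: digraph_dist_same_side proj_in_verts digraph_dist_le_diameter mult_left_mono)
  show "digraph_dist A u v \<le> 2 * digraph_diameter G + 1"
  proof (cases "side u = side v")
    case True
    then show ?thesis
      using same_side[OF u] by (simp add: add_increasing2)
  next
    case False
    obtain w where arc: "u \<rightarrow>\<^bsub>A\<^esub> w" using ex_arc[OF u] by blast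
    have "digraph_dist A u v \<le> eSuc (digraph_dist A w v)"
      by (rule A.digraph_dist_le_eSuc_if_arc[OF arc])
    also have "\<dots> \<le> eSuc (2 * digraph_diameter G)"
      using same_side[of w] arc False arc_changes_side A.adj_in_verts(2) by simp
    finally show ?thesis by (simp add: eSuc_plus_1)
  qed
qed

end

section \<open>The square of a New Amsterdam digraph\<close>

lemma double_step_graph_arc_iff:
  "(i, j) \<in> parcs (double_step_graph N a b) \<longleftrightarrow>
     i \<in> {0..<int N} \<and> (\<exists>x \<in> {a, - a, b, - b}. j = (i + x) mod int N)"
  unfolding double_step_graph_def pair_pre_digraph.simps by blast

lemma new_amsterdam_arc_iff:
  "(u, v) \<in> parcs (new_amsterdam M \<alpha> \<beta> \<gamma> \<delta>) \<longleftrightarrow>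
     u \<in> {0..<int M} \<and> (\<exists>s \<in> if even u then {\<alpha>, \<beta>} else {\<gamma>, \<delta>}. v = (u + s) mod int M)"
  unfolding new_amsterdam_def pair_pre_digraph.simps by (cases "even u") auto

lemma eq_mod_double_iff:
  fixes u v x n :: int
  assumes "even u = even v" "n > 0"
  shows "v = (u + 2 * x) mod (2 * n) \<longleftrightarrow> v div 2 = (u div 2 + x) mod n"
proof -
  have "(u + 2 * x) mod (2 * n) = 2 * ((u div 2 + x) mod n) + v mod 2"
    using assms zmod_zmult2_eq[of n "u + 2 * x" 2] by (simp add: mod_2_eq_odd add.commute)
  moreover have "v = 2 * (v div 2) + v mod 2"
    by simp
  ultimately show ?thesis by linarith
qed

locale new_amsterdam_double_step =
  fixes N :: nat and a b \<alpha> \<beta> \<gamma> \<delta> :: int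
  assumes N_pos: "N > 0"
    and odd_\<alpha>: "odd \<alpha>"
    and dvd_sum: "2 * int N dvd \<alpha> + \<beta> + \<gamma> + \<delta>"
    and \<alpha>_plus_\<gamma>: "\<alpha> + \<gamma> = 2 * a"
    and \<alpha>_plus_\<delta>: "\<alpha> + \<delta> = - 2 * b"
begin

abbreviation NA :: "int pair_pre_digraph" where
  "NA \<equiv> new_amsterdam (2 * N) \<alpha> \<beta> \<gamma> \<delta>"

definition steps :: "int \<Rightarrow> int set" where
  "steps u = (if even u then {\<alpha>, \<beta>} else {\<gamma>, \<delta>})"

lemma NA_arc_iff:
  "(u, v) \<in> parcs NA \<longleftrightarrow> u \<in> {0..<2 * int N} \<and> (\<exists>s \<in> steps u. v = (u + s) mod (2 * int N))"
  by (simp add: new_amsterdam_arc_iff steps_def)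

lemma odd_steps: "odd \<beta>" "odd \<gamma>" "odd \<delta>"
proof -
  have "even (\<alpha> + \<gamma>)" "even (\<alpha> + \<delta>)"
    by (simp_all add: \<alpha>_plus_\<gamma> \<alpha>_plus_\<delta>)
  then show "odd \<gamma>" "odd \<delta>"
    using odd_\<alpha> by simp_all
  have "even (\<alpha> + \<beta> + \<gamma> + \<delta>)"
    using dvd_sum by (rule dvd_mult_left)
  then show "odd \<beta>"
    using odd_\<alpha> \<open>odd \<gamma>\<close> \<open>odd \<delta>\<close> by simp
qed

lemma NA_arc_parity: "(u, v) \<in> parcs NA \<Longrightarrow> even v \<longleftrightarrow> odd u"
  using odd_\<alpha> odd_steps by (auto simp: NA_arc_iff steps_def dvd_mod_iff split: if_splits)

lemma two_step_sum_iff: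
  "(\<exists>s \<in> steps u. \<exists>t \<in> steps (u + s). P (s + t)) \<longleftrightarrow>
     (\<exists>s \<in> {\<alpha>, \<beta>}. \<exists>t \<in> {\<gamma>, \<delta>}. P (s + t))"
proof (cases "even u")
  case True
  then have "steps u = {\<alpha>, \<beta>}" "\<forall>s \<in> {\<alpha>, \<beta>}. steps (u + s) = {\<gamma>, \<delta>}"
    using odd_\<alpha> odd_steps by (simp_all add: steps_def)
  then show ?thesis by simp
next
  case False
  then have "steps u = {\<gamma>, \<delta>}" "\<forall>t \<in> {\<gamma>, \<delta>}. steps (u + t) = {\<alpha>, \<beta>}"
    using odd_\<alpha> odd_steps by (simp_all add: steps_def)
  then show ?thesis
    by (simp add: add.commute) blast
qed

lemma two_step_displacement_iff:
  "(\<exists>s \<in> {\<alpha>, \<beta>}. \<exists>t \<in> {\<gamma>, \<delta>}. w = (u + (s + t)) mod (2 * int N)) \<longleftrightarrow>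
     (\<exists>x \<in> {a, - a, b, - b}. w = (u + 2 * x) mod (2 * int N))"
proof -
  obtain c where "\<alpha> + \<beta> + \<gamma> + \<delta> = 2 * int N * c"
    using dvd_sum by blast
  then have "u + (\<beta> + \<gamma>) = u + 2 * b + 2 * int N * c" "u + (\<beta> + \<delta>) = u + 2 * (- a) + 2 * int N * c"
    using \<alpha>_plus_\<gamma> \<alpha>_plus_\<delta> by simp_all
  then have "(u + (\<beta> + \<gamma>)) mod (2 * int N) = (u + 2 * b) mod (2 * int N)"
      "(u + (\<beta> + \<delta>)) mod (2 * int N) = (u + 2 * (- a)) mod (2 * int N)"
    by (simp_all only: mod_mult_self2)
  then show ?thesis
    using \<alpha>_plus_\<gamma> \<alpha>_plus_\<delta> by auto
qed

lemma NA_two_arcs_iff: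
  "(u, w) \<in> parcs NA ^^ 2 \<longleftrightarrow>
     u \<in> {0..<2 * int N} \<and> (\<exists>x \<in> {a, - a, b, - b}. w = (u + 2 * x) mod (2 * int N))"
proof -
  have in_range: "v mod (2 * int N) \<in> {0..<2 * int N}"
    and steps_mod: "steps (v mod (2 * int N)) = steps v" for v
    using N_pos by (simp_all add: steps_def dvd_mod_iff)
  have mod_step: "((u + s) mod (2 * int N) + t) mod (2 * int N) = (u + (s + t)) mod (2 * int N)" for s t
    by (simp add: mod_add_left_eq add.assoc)
  have "(u, w) \<in> parcs NA ^^ 2 \<longleftrightarrow> (\<exists>v. (u, v) \<in> parcs NA \<and> (v, w) \<in> parcs NA)"
    by (auto simp: numeral_2_eq_2)
  also have "\<dots> \<longleftrightarrow> u \<in> {0..<2 * int N} \<and>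
      (\<exists>s \<in> steps u. \<exists>t \<in> steps (u + s). w = (u + (s + t)) mod (2 * int N))"
    unfolding NA_arc_iff by (metis in_range mod_step steps_mod)
  finally show ?thesis
    using two_step_sum_iff[of u "\<lambda>x. w = (u + x) mod (2 * int N)"] two_step_displacement_iff by metis
qed

sublocale bipartite_square_root
  "with_proj NA" "with_proj (double_step_graph N a b)" even "\<lambda>u. u div 2"
proof (intro bipartite_square_root.intro bipartite_square_root_axioms.intro)
  show "wf_digraph (with_proj NA)"
    by (simp add: wf_digraph_wp_iff pair_wf_digraph_new_amsterdam)
  interpret G: pair_sym_digraph "double_step_graph N a b"
    by (rule pair_sym_digraph_double_step_graph)
  show "wf_digraph (with_proj (double_step_graph N a b))" ..
  have pverts: "pverts NA = {0..<2 * int N}" "pverts (double_step_graph N a b) = {0..<int N}"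
    by (simp_all add: new_amsterdam_def double_step_graph_def)
  show "even v \<longleftrightarrow> odd u" if "u \<rightarrow>\<^bsub>with_proj NA\<^esub> v" for u v
    using that NA_arc_parity by simp
  show "\<exists>v. u \<rightarrow>\<^bsub>with_proj NA\<^esub> v" if "u \<in> verts (with_proj NA)" for u
    using that unfolding with_proj_simps pverts NA_arc_iff steps_def by auto
  show "bij_betw (\<lambda>u. (even u, u div 2)) (verts (with_proj NA))
      (UNIV \<times> verts (with_proj (double_step_graph N a b)))"
    unfolding with_proj_simps pverts
    by (rule bij_betw_byWitness[where f' = "\<lambda>(e, i). 2 * i + of_bool (\<not> e)"]) auto
  show "(u, v) \<in> arcs_ends (with_proj NA) ^^ 2 \<longleftrightarrow>
      (u div 2) \<rightarrow>\<^bsub>with_proj (double_step_graph N a b)\<^esub> (v div 2)"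
    if "u \<in> verts (with_proj NA)" "v \<in> verts (with_proj NA)" "even u = even v" for u v
  proof -
    have "u \<in> {0..<2 * int N}" "u div 2 \<in> {0..<int N}"
      using that(1) unfolding with_proj_simps pverts by auto
    then show ?thesis
      using that(3) N_pos
      by (simp add: NA_two_arcs_iff double_step_graph_arc_iff eq_mod_double_iff
          del: atLeastLessThan_iff)
  qed
qed

end

theorem theorem3p1:
  fixes N k :: nat and a b :: int
  assumes "N \<ge> 1" and "a \<noteq> b" and "gcd (int N) (gcd a b) = 1"
    and "digraph_diameter (with_proj (double_step_graph N a b)) = enat k"
  shows "enat (2 * k)
           \<le> digraph_diameter (with_proj
               (new_amsterdam (2 * N) (- 1) (2 * (b - a) - 1) (2 * a + 1) (- 2 * b + 1)))
       \<and> digraph_diameter (with_proj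
               (new_amsterdam (2 * N) (- 1) (2 * (b - a) - 1) (2 * a + 1) (- 2 * b + 1)))
           \<le> enat (2 * k + 1)"
proof -
  interpret new_amsterdam_double_step N a b "- 1" "2 * (b - a) - 1" "2 * a + 1" "- 2 * b + 1"
    using assms(1) by unfold_locales simp_all
  show ?thesis
    using diameter_lower_bound diameter_upper_bound assms(4)
    by (simp add: numeral_eq_enat one_enat_def)
qed

end
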